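(* Let $h\colon U\to U$ be a diffeomorphism and let $\Psi(u,u^\ast)=\big(h(u),\,-u^\ast\circ(\mathrm Dh(u))^{-1}\big)$ on $V=U\oplus U^\ast$. Suppose $\Psi$ is a reversal symmetry for every map of a family $(\phi_\mu)_\mu$ of symplectic maps with generating functions $S_\mu$, and suppose a family of separated Lagrangian boundary conditions $v\in G_\mu$, $\phi_\mu(v)\in\underline G_\mu$, with generating functions $B_\mu(u,\underline u)=b_\mu(u)-\underline b_\mu(\underline u)$, is given which is invariant under $\Psi$ in the sense that $\Psi(G_\mu)=\underline G_\mu$ and $\Psi(\underline G_\mu)=G_\mu$. Then the local Lagrangian boundary value problem behaves like the gradient-zero problem $\nabla\tilde S_\mu(u,\underline u)=0$ with symmetry $\tilde S_\mu\circ(h\,\underline\times\,h)=\tilde S_\mu$ (up to a constant), where $\tilde S_\mu=S_\mu-B_\mu$; that is, solutions of the boundary value problem correspond to the critical points $(u,\underline u)$ of $\tilde S_\mu$, and $\tilde S_\mu$ has the stated symmetry.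
   Context: $U$ is a finite-dimensional real vector space, $V=U\oplus U^\ast$ carries the symplectic form $\omega((u,u^\ast),(v,v^\ast))=u^\ast(v)-v^\ast(u)$, and $\underline V=\underline U\oplus\underline U^\ast$ is a copy of $(V,\omega)$, identified with $V$ where needed. Each $\phi_\mu\colon V\to\underline V$ is a symplectic map with generating function $S_\mu\colon U\oplus\underline U\to\mathbb R$, i.e. $$\{(v,\phi_\mu(v)): v\in V\}=\{(u,\mathrm D_uS_\mu(u,\underline u),\underline u,-\mathrm D_{\underline u}S_\mu(u,\underline u)):(u,\underline u)\in U\oplus\underline U\} .$$ The boundary conditions are given by $G_\mu=\{(u,\mathrm Db_\mu(u)):u\in U\}$ and $\underline G_\mu=\{(\underline u,\mathrm D\underline b_\mu(\underline u)):\underline u\in\underline U\}$ for smooth $b_\mu\colon U\to\mathbb R$, $\underline b_\mu\colon\underline U\to\mathbb R$. $(h\,\underline\times\,h)(u,\underline u)=(h(\underline u),h(u))$. All maps are local (defined on neighbourhoods of $0$, shrunk if necessary; this is suppressed in the notation). $\Psi$ (which is anti-symplectic, $\Psi^\ast\omega=-\omega$) is a reversal symmetry for $\phi_\mu$ if $\Psi^{-1}\circ\phi_\mu\circ\Psi=\phi_\mu^{-1}$. *)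

theory Defs
  imports "HOL-Analysis.Analysis"
begin

text \<open>
  \<^typ>\<open>'u::euclidean_space\<close> plays the role of the real vector space \<open>U\<close> (and of its copy); its inner
  product is never used.  The dual \<open>U*\<close> is \<^typ>\<open>'u \<Rightarrow>\<^sub>L real\<close>, the space of all linear functionals, as
  the dimension is finite.  Maps are local: each comes with an explicit open domain, its values
  outside this domain are irrelevant, and an identity between composites of local maps is
  understood to hold at the points where both sides are defined.
\<close>

type_synonym 'u cotangent = "'u \<times> ('u \<Rightarrow>\<^sub>L real)"

text \<open>Iterated directional derivatives: on an open subset of a finite-dimensional space this is the
  usual notion of a \<open>C\<^sup>n\<close> map.\<close>

primrec Ck_on :: "nat \<Rightarrow> ('a::real_normed_vector \<Rightarrow> 'b::real_normed_vector) \<Rightarrow> 'a set \<Rightarrow> bool" where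
  "Ck_on 0 f X \<longleftrightarrow> continuous_on X f"
| "Ck_on (Suc n) f X \<longleftrightarrow> (\<forall>x\<in>X. f differentiable (at x)) \<and>
     (\<forall>v. Ck_on n (\<lambda>x. frechet_derivative f (at x) v) X)"

definition smooth_on :: "'a set \<Rightarrow> ('a::real_normed_vector \<Rightarrow> 'b::real_normed_vector) \<Rightarrow> bool" where
  "smooth_on X f \<longleftrightarrow> (\<forall>n. Ck_on n f X)"

definition diffeo_on :: "'a set \<Rightarrow> ('a::real_normed_vector \<Rightarrow> 'b::real_normed_vector) \<Rightarrow> bool" where
  "diffeo_on X f \<longleftrightarrow> open X \<and> open (f ` X) \<and> inj_on f X \<and> smooth_on X f \<and>
     smooth_on (f ` X) (inv_into X f)"

definition Diff :: "('a::real_normed_vector \<Rightarrow> 'b::real_normed_vector) \<Rightarrow> 'a \<Rightarrow> ('a \<Rightarrow>\<^sub>L 'b)" where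
  "Diff f x = Blinfun (frechet_derivative f (at x))"

definition Diff1 :: "('u::euclidean_space \<times> 'u \<Rightarrow> real) \<Rightarrow> 'u \<times> 'u \<Rightarrow> ('u \<Rightarrow>\<^sub>L real)" where
  "Diff1 S = (\<lambda>(u, u'). Diff (\<lambda>x. S (x, u')) u)"

definition Diff2 :: "('u::euclidean_space \<times> 'u \<Rightarrow> real) \<Rightarrow> 'u \<times> 'u \<Rightarrow> ('u \<Rightarrow>\<^sub>L real)" where
  "Diff2 S = (\<lambda>(u, u'). Diff (\<lambda>x. S (u, x)) u')"

definition critical_point :: "('a::real_normed_vector \<Rightarrow> real) \<Rightarrow> 'a \<Rightarrow> bool" where
  "critical_point f x \<longleftrightarrow> (f has_derivative (\<lambda>_. 0)) (at x)"

definition omega :: "'u::euclidean_space cotangent \<Rightarrow> 'u cotangent \<Rightarrow> real" where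
  "omega = (\<lambda>(u, p) (v, q). blinfun_apply p v - blinfun_apply q u)"

definition symplectic_on ::
  "'u::euclidean_space cotangent set \<Rightarrow> ('u cotangent \<Rightarrow> 'u cotangent) \<Rightarrow> bool" where
  "symplectic_on D \<phi> \<longleftrightarrow> diffeo_on D \<phi> \<and>
     (\<forall>v\<in>D. \<forall>x y. omega (frechet_derivative \<phi> (at v) x) (frechet_derivative \<phi> (at v) y) = omega x y)"

definition generating_function ::
  "'u::euclidean_space cotangent set \<Rightarrow> ('u cotangent \<Rightarrow> 'u cotangent) \<Rightarrow>
   ('u \<times> 'u) set \<Rightarrow> ('u \<times> 'u \<Rightarrow> real) \<Rightarrow> bool" where
  "generating_function D \<phi> W S \<longleftrightarrow> open W \<and> smooth_on W S \<and>
     {(v, \<phi> v) |v. v \<in> D} =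
     {((u, Diff1 S (u, u')), (u', - Diff2 S (u, u'))) |u u'. (u, u') \<in> W}"

definition graph_d :: "'u set \<Rightarrow> ('u::euclidean_space \<Rightarrow> real) \<Rightarrow> 'u cotangent set" where
  "graph_d X b = {(u, Diff b u) |u. u \<in> X}"

definition Psi :: "('u::euclidean_space \<Rightarrow> 'u) \<Rightarrow> 'u cotangent \<Rightarrow> 'u cotangent" where
  "Psi h = (\<lambda>(u, p). (h u, - (p o\<^sub>L Blinfun (inv (frechet_derivative h (at u))))))"

text \<open>The points at which \<open>\<Psi>\<inverse> \<circ> \<phi> \<circ> \<Psi>\<close> and \<open>\<phi>\<inverse>\<close> are both defined, for \<open>\<phi>\<close> with domain \<open>D\<close> and
  \<open>\<Psi>\<close> with domain \<open>E\<close>.\<close>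

definition reversal_domain :: "'v set \<Rightarrow> ('v \<Rightarrow> 'v) \<Rightarrow> 'v set \<Rightarrow> ('v \<Rightarrow> 'v) \<Rightarrow> 'v set" where
  "reversal_domain D \<phi> E \<Psi> = {w \<in> E \<inter> \<phi> ` D. \<Psi> w \<in> D \<and> \<phi> (\<Psi> w) \<in> \<Psi> ` E}"

definition reversal_symmetry :: "'v set \<Rightarrow> ('v \<Rightarrow> 'v) \<Rightarrow> 'v set \<Rightarrow> ('v \<Rightarrow> 'v) \<Rightarrow> bool" where
  "reversal_symmetry D \<phi> E \<Psi> \<longleftrightarrow>
     (\<forall>w \<in> reversal_domain D \<phi> E \<Psi>. inv_into E \<Psi> (\<phi> (\<Psi> w)) = inv_into D \<phi> w)"

text \<open>Local form of \<open>\<Psi>(G) = G'\<close>, where \<open>G\<close> and \<open>G'\<close> are the graphs of \<open>Db\<close> over \<open>X\<close> and of \<open>Db'\<close> over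
  \<open>Y\<close>, and \<open>h\<close> has domain \<open>A\<close>: \<open>\<Psi>(G)\<close> is defined over \<open>h(X \<inter> A)\<close>, and the two sets are compared over
  \<open>Y \<inter> h(X \<inter> A)\<close>.\<close>

definition Psi_maps_graph ::
  "'u set \<Rightarrow> ('u::euclidean_space \<Rightarrow> 'u) \<Rightarrow> 'u set \<Rightarrow> ('u \<Rightarrow> real) \<Rightarrow> 'u set \<Rightarrow> ('u \<Rightarrow> real) \<Rightarrow> bool" where
  "Psi_maps_graph A h X b Y b' \<longleftrightarrow>
     Psi h ` graph_d (X \<inter> A) b \<inter> (Y \<times> UNIV) = graph_d (Y \<inter> h ` (X \<inter> A)) b'"

definition bvp_solutions ::
  "'u::euclidean_space cotangent set \<Rightarrow> ('u cotangent \<Rightarrow> 'u cotangent) \<Rightarrow>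
   'u set \<Rightarrow> ('u \<Rightarrow> real) \<Rightarrow> 'u set \<Rightarrow> ('u \<Rightarrow> real) \<Rightarrow> 'u cotangent set" where
  "bvp_solutions D \<phi> X b Y b' = {v \<in> D. v \<in> graph_d X b \<and> \<phi> v \<in> graph_d Y b'}"

definition S_tilde ::
  "('u \<times> 'u \<Rightarrow> real) \<Rightarrow> ('u \<Rightarrow> real) \<Rightarrow> ('u \<Rightarrow> real) \<Rightarrow> 'u \<times> 'u \<Rightarrow> real" where
  "S_tilde S b b' = (\<lambda>(u, u'). S (u, u') - (b u - b' u'))"

definition swap_prod :: "('u \<Rightarrow> 'u) \<Rightarrow> 'u \<times> 'u \<Rightarrow> 'u \<times> 'u" where
  "swap_prod h = (\<lambda>(u, u'). (h u', h u))"

text \<open>The points \<open>(u, u')\<close> of the domain of \<open>S - B\<close> which \<open>swap_prod h\<close> maps into this domain,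
  and for which the reversal identity makes sense at \<open>\<phi>(v)\<close>, where \<open>(v, \<phi>(v))\<close> is the point of the
  graph of \<open>\<phi>\<close> over \<open>(u, u')\<close>.  If all maps are globally defined and \<open>h\<close> is bijective, this is the whole space.\<close>

definition symmetry_domain ::
  "'u set \<Rightarrow> ('u::euclidean_space \<Rightarrow> 'u) \<Rightarrow> 'u cotangent set \<Rightarrow> ('u cotangent \<Rightarrow> 'u cotangent) \<Rightarrow>
   ('u \<times> 'u) set \<Rightarrow> ('u \<times> 'u \<Rightarrow> real) \<Rightarrow> 'u set \<Rightarrow> 'u set \<Rightarrow> ('u \<times> 'u) set" where
  "symmetry_domain A h D \<phi> W S X Y =
     {(u, u') \<in> W \<inter> (X \<times> Y). u \<in> A \<and> u' \<in> A \<and> swap_prod h (u, u') \<in> W \<inter> (X \<times> Y) \<and>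
        (u', - Diff2 S (u, u')) \<in> reversal_domain D \<phi> (A \<times> UNIV) (Psi h)}"

end

theory Submission
  imports Defs
begin

text \<open>
  The graph of \<open>\<phi>\<close> meets \<open>G \<times> G'\<close> exactly where the two differentials \<open>DS\<close> and \<open>DB\<close> agree, which gives
  the correspondence with critical points.  The reversal symmetry says that the graph of \<open>\<phi>\<close> is
  invariant under \<open>(v, w) \<mapsto> (\<Psi> w, \<Psi> v)\<close>, which covers \<open>swap_prod h\<close>; as \<open>\<Psi>\<close> is the negative of the
  cotangent lift of \<open>h\<close>, this reads \<open>D(S \<circ> swap_prod h) = DS\<close>.  The invariance of the boundary
  conditions gives the same for \<open>B\<close>, so \<open>S_tilde \<circ> swap_prod h - S_tilde\<close> is locally constant.
\<close>

section \<open>Total derivatives of smooth maps\<close>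

text \<open>\<open>Blinfun\<close> represents its argument only if that argument is bounded linear.
  Differentiability supplies this, so that \<open>Diff f x\<close> is the true derivative and not an
  unspecified value.\<close>

lemma has_derivative_Diff:
  assumes "f differentiable (at x)"
  shows "(f has_derivative blinfun_apply (Diff f x)) (at x)"
proof -
  have "(f has_derivative frechet_derivative f (at x)) (at x)"
    using assms frechet_derivative_works by blast
  then show ?thesis
    unfolding Diff_def
    by (simp add: bounded_linear_Blinfun_apply has_derivative_bounded_linear)
qed

lemma Diff_eqI:
  assumes "(f has_derivative blinfun_apply L) (at x)"
  shows "Diff f x = L"
  unfolding Diff_def using frechet_derivative_at[OF assms]
  by (metis blinfun_apply_inverse)

lemma smooth_on_differentiable:
  assumes "smooth_on X f" "x \<in> X"
  shows "f differentiable (at x)"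
  using assms Ck_on.simps(2)[of 0 f X] unfolding smooth_on_def by blast

lemma smooth_on_has_derivative:
  assumes "smooth_on X f" "x \<in> X"
  shows "(f has_derivative blinfun_apply (Diff f x)) (at x)"
  using assms by (intro has_derivative_Diff smooth_on_differentiable)

lemma smooth_on_continuous_on:
  assumes "smooth_on X f"
  shows "continuous_on X f"
  using assms Ck_on.simps(1)[of f X] unfolding smooth_on_def by blast

text \<open>In finite dimension, continuity in operator norm can be tested on basis vectors, and
  there it is the level \<open>Suc 0\<close> of \<open>Ck_on\<close>.\<close>

lemma smooth_on_continuous_on_Diff:
  fixes f :: "'a::euclidean_space \<Rightarrow> 'b::real_normed_vector"
  assumes "smooth_on X f"
  shows "continuous_on X (Diff f)"
proof (rule continuous_on_blinfun_componentwise)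
  fix i :: 'a
  have "continuous_on X (\<lambda>x. frechet_derivative f (at x) i)"
    using assms Ck_on.simps(2)[of 0 f X] unfolding smooth_on_def by (metis Ck_on.simps(1))
  moreover have "blinfun_apply (Diff f x) i = frechet_derivative f (at x) i" if "x \<in> X" for x
    using frechet_derivative_at[OF smooth_on_has_derivative[OF assms that]] by simp
  ultimately show "continuous_on X (\<lambda>x. blinfun_apply (Diff f x) i)"
    by (simp cong: continuous_on_cong)
qed

text \<open>The set \<open>C\<close> need not be open, so the vanishing derivative is integrated
  over the connected component of \<open>T\<close> around \<open>C\<close>, which is open.\<close>

lemma has_derivative_zero_constant_on_connected_subset:
  fixes f :: "'a::euclidean_space \<Rightarrow> 'b::real_normed_vector"
  assumes "open T" "\<And>x. x \<in> T \<Longrightarrow> (f has_derivative (\<lambda>_. 0)) (at x)" "connected C" "C \<subseteq> T"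
  shows "\<exists>c. \<forall>x\<in>C. f x = c"
proof (cases "C = {}")
  case False
  then obtain a where a: "a \<in> C" by blast
  let ?K = "connected_component_set T a"
  have K: "open ?K" "connected ?K" "?K \<subseteq> T"
    using assms(1) by (auto simp: open_connected_component connected_component_subset)
  have C: "C \<subseteq> ?K"
    using a assms(3,4) by (intro connected_component_maximal)
  have "f x = f a" if "x \<in> C" for x
    using has_derivative_zero_unique_connected[OF K(1,2), of f x a] assms(2) K(3) C a that by blast
  then show ?thesis by blast
qed simp

section \<open>The cotangent lift of a diffeomorphism\<close>

lemma diffeo_on_Diff_inverse:
  fixes h :: "'u::euclidean_space \<Rightarrow> 'v::euclidean_space"
  assumes "diffeo_on A h" "u \<in> A"
  defines "g \<equiv> inv_into A h"
  shows "Diff g (h u) o\<^sub>L Diff h u = id_blinfun" "Diff h u o\<^sub>L Diff g (h u) = id_blinfun"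
proof -
  have *: "open A" "open (h ` A)" "inj_on h A" "smooth_on A h" "smooth_on (h ` A) g"
    using assms unfolding diffeo_on_def by auto
  have dh: "(h has_derivative Diff h u) (at u)"
    using * assms(2) by (intro smooth_on_has_derivative)
  have dg: "(g has_derivative Diff g (h u)) (at (h u))"
    using * assms(2) by (intro smooth_on_has_derivative) auto
  have gh: "g (h x) = x" if "x \<in> A" for x
    using that *(3) by (simp add: g_def)
  have hg: "h (g y) = y" if "y \<in> h ` A" for y
    using that by (simp add: g_def f_inv_into_f)
  have "((\<lambda>x. g (h x)) has_derivative (\<lambda>x. Diff g (h u) (Diff h u x))) (at u)"
    using dh dg has_derivative_compose by blast
  then have "((\<lambda>x. x) has_derivative (\<lambda>x. Diff g (h u) (Diff h u x))) (at u)"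
    by (rule has_derivative_transform_within_open[OF _ *(1) assms(2)]) (simp add: gh)
  then have "(\<lambda>x. Diff g (h u) (Diff h u x)) = (\<lambda>x. x)"
    using has_derivative_unique has_derivative_ident by blast
  then show "Diff g (h u) o\<^sub>L Diff h u = id_blinfun"
    by (auto intro!: blinfun_eqI dest: fun_cong)
  have "(h has_derivative Diff h u) (at (g (h u)))"
    using dh gh[OF assms(2)] by simp
  then have "((\<lambda>y. h (g y)) has_derivative (\<lambda>y. Diff h u (Diff g (h u) y))) (at (h u))"
    using dg has_derivative_compose by blast
  then have "((\<lambda>y. y) has_derivative (\<lambda>y. Diff h u (Diff g (h u) y))) (at (h u))"
    by (rule has_derivative_transform_within_open[OF _ *(2)]) (use assms(2) in \<open>auto simp: hg\<close>)
  then have "(\<lambda>y. Diff h u (Diff g (h u) y)) = (\<lambda>y. y)"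
    using has_derivative_unique has_derivative_ident by blast
  then show "Diff h u o\<^sub>L Diff g (h u) = id_blinfun"
    by (auto intro!: blinfun_eqI dest: fun_cong)
qed

text \<open>The pointwise inverse in the definition of \<open>Psi\<close> is traded for the
  derivative of the inverse map, whose continuous dependence on the base point is known.\<close>

lemma Psi_eq:
  assumes "diffeo_on A h" "u \<in> A"
  shows "Psi h (u, p) = (h u, - (p o\<^sub>L Diff (inv_into A h) (h u)))"
proof -
  let ?g = "Diff (inv_into A h) (h u)"
  have "frechet_derivative h (at u) = Diff h u"
    using assms frechet_derivative_at smooth_on_has_derivative unfolding diffeo_on_def by metis
  moreover have "inv (blinfun_apply (Diff h u)) = blinfun_apply ?g"
  proof (rule inv_equality)
    show "?g (Diff h u x) = x" for x
      using diffeo_on_Diff_inverse(1)[OF assms] by (metis blinfun_apply_blinfun_compose id_blinfun.rep_eq)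
    show "Diff h u (?g x) = x" for x
      using diffeo_on_Diff_inverse(2)[OF assms] by (metis blinfun_apply_blinfun_compose id_blinfun.rep_eq)
  qed
  ultimately show ?thesis
    by (simp add: Psi_def blinfun_apply_inverse)
qed

text \<open>The form in which \<open>Psi\<close> enters all later computations: testing the new
  covector on vectors pushed forward by \<open>Diff h u\<close> cancels the inverse.\<close>

lemma Psi_snd_Diff:
  assumes "diffeo_on A h" "u \<in> A" "Psi h (u, p) = (y, q)"
  shows "blinfun_apply q (Diff h u x) = - blinfun_apply p x"
proof -
  have "q = - (p o\<^sub>L Diff (inv_into A h) (h u))"
    using trans[OF Psi_eq[OF assms(1,2), of p, symmetric] assms(3)] by blast
  then show ?thesis
    using diffeo_on_Diff_inverse(1)[OF assms(1,2)]
    by (metis blinfun.minus_left blinfun_apply_blinfun_compose id_blinfun.rep_eq)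
qed

lemma Psi_continuous_on:
  assumes "diffeo_on A h"
  shows "continuous_on (A \<times> UNIV) (Psi h)"
proof -
  have *: "continuous_on A h" "continuous_on (h ` A) (Diff (inv_into A h))"
    using assms smooth_on_continuous_on smooth_on_continuous_on_Diff unfolding diffeo_on_def by blast+
  have "continuous_on (A \<times> UNIV) (\<lambda>w. (h (fst w), - (snd w o\<^sub>L Diff (inv_into A h) (h (fst w)))))"
    by (intro continuous_intros continuous_on_compose2[OF *(1)] continuous_on_compose2[OF *(2)]) auto
  then show ?thesis
    by (rule continuous_on_eq) (use Psi_eq[OF assms] in auto)
qed

text \<open>\<open>Psi h\<close> is bijective from each fibre over \<open>u\<close> to the fibre
  over \<open>h u\<close>. Its range is therefore open, and membership in it is a condition on the
  base point alone.\<close>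

lemma Psi_image:
  assumes "diffeo_on A h"
  shows "Psi h ` (A \<times> UNIV) = h ` A \<times> UNIV"
proof (intro equalityI subsetI)
  fix w assume "w \<in> h ` A \<times> (UNIV :: ('a \<Rightarrow>\<^sub>L real) set)"
  then obtain u q where w: "w = (h u, q)" "u \<in> A" by auto
  have "Diff h u (Diff (inv_into A h) (h u) y) = y" for y
    using diffeo_on_Diff_inverse(2)[OF assms w(2)]
    by (metis blinfun_apply_blinfun_compose id_blinfun.rep_eq)
  \<comment> \<open>The preimage is found by solving for the covector: pull \<open>q\<close> back
    along \<open>h\<close> and change the sign.\<close>
  then have "Psi h (u, - (q o\<^sub>L Diff h u)) = w"
    unfolding w(1) Psi_eq[OF assms w(2)]
    by (auto intro!: blinfun_eqI simp: blinfun.minus_left)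
  then show "w \<in> Psi h ` (A \<times> UNIV)" using w(2) by (metis SigmaI UNIV_I imageI)
qed (auto simp: Psi_def)

lemma open_reversal_domain:
  assumes "diffeo_on A h" "diffeo_on D \<phi>"
  shows "open (reversal_domain D \<phi> (A \<times> UNIV) (Psi h))"
proof -
  have o: "open A" "open (h ` A)" "open D" "open (\<phi> ` D)" "continuous_on D \<phi>"
    using assms smooth_on_continuous_on unfolding diffeo_on_def by auto
  have "open (D \<inter> \<phi> -` (h ` A \<times> UNIV))"
    using o by (intro continuous_open_preimage open_Times) auto
  then have "open ((A \<times> UNIV) \<inter> Psi h -` (D \<inter> \<phi> -` (h ` A \<times> UNIV)))"
    using o by (intro continuous_open_preimage Psi_continuous_on assms open_Times) auto
  then have "open (\<phi> ` D \<inter> ((A \<times> UNIV) \<inter> Psi h -` (D \<inter> \<phi> -` (h ` A \<times> UNIV))))"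
    using o(4) by blast
  moreover have "reversal_domain D \<phi> (A \<times> UNIV) (Psi h)
      = \<phi> ` D \<inter> ((A \<times> UNIV) \<inter> Psi h -` (D \<inter> \<phi> -` (h ` A \<times> UNIV)))"
    unfolding reversal_domain_def Psi_image[OF assms(1)] by blast
  ultimately show ?thesis by simp
qed

text \<open>\<open>Psi h\<close> covers \<open>h\<close>, and a graph has a single point over
  \<open>h u\<close>. The image of the point over \<open>u\<close> must be that point, which fixes
  its covector.\<close>

lemma Psi_maps_graph_Diff:
  assumes "diffeo_on A h" "Psi_maps_graph A h X b Y b'" "u \<in> X \<inter> A" "h u \<in> Y"
  shows "blinfun_apply (Diff b' (h u)) (Diff h u x) = - blinfun_apply (Diff b u) x"
proof (rule Psi_snd_Diff[OF assms(1)])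
  obtain q where q: "Psi h (u, Diff b u) = (h u, q)"
    by (simp add: Psi_def)
  have "(h u, q) \<in> Psi h ` graph_d (X \<inter> A) b \<inter> (Y \<times> UNIV)"
    using assms(3,4) imageI[of "(u, Diff b u)" "graph_d (X \<inter> A) b" "Psi h"] q
    unfolding graph_d_def by auto
  then have "(h u, q) \<in> graph_d (Y \<inter> h ` (X \<inter> A)) b'"
    using assms(2) unfolding Psi_maps_graph_def by simp
  then show "Psi h (u, Diff b u) = (h u, Diff b' (h u))"
    using q by (auto simp: graph_d_def)
qed (use assms in auto)

section \<open>Partial derivatives\<close>

text \<open>Chain rule along the two slices through \<open>p\<close>; \<open>?l\<close> and
  \<open>?r\<close> are the inclusions of the two factors.\<close>

lemma Diff_partial:
  assumes "(S has_derivative blinfun_apply L) (at p)"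
  shows "blinfun_apply (Diff1 S p) x = blinfun_apply L (x, 0)"
    and "blinfun_apply (Diff2 S p) x = blinfun_apply L (0, x)"
proof -
  obtain u u' where p: "p = (u, u')" by fastforce
  let ?l = "Blinfun (\<lambda>x::'a. (x, 0::'a))" and ?r = "Blinfun (\<lambda>x::'a. (0::'a, x))"
  have l: "blinfun_apply ?l = (\<lambda>x. (x, 0))"
    by (intro bounded_linear_Blinfun_apply bounded_linear_Pair bounded_linear_ident bounded_linear_zero)
  have r: "blinfun_apply ?r = (\<lambda>x. (0, x))"
    by (intro bounded_linear_Blinfun_apply bounded_linear_Pair bounded_linear_ident bounded_linear_zero)
  have dS: "(S has_derivative blinfun_apply L) (at (u, u'))"
    using assms p by simp
  have "((\<lambda>x. S (x, u')) has_derivative (\<lambda>x. L (x, 0))) (at u)"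
    by (rule has_derivative_compose[where g = S and f = "\<lambda>x. (x, u')", OF _ dS])
      (auto intro!: derivative_eq_intros)
  then have "Diff (\<lambda>x. S (x, u')) u = L o\<^sub>L ?l"
    by (intro Diff_eqI) (simp add: blinfun_compose.rep_eq l comp_def)
  then show "blinfun_apply (Diff1 S p) x = L (x, 0)"
    by (simp add: Diff1_def p l)
  have "((\<lambda>x. S (u, x)) has_derivative (\<lambda>x. L (0, x))) (at u')"
    by (rule has_derivative_compose[where g = S and f = "\<lambda>x. (u, x)", OF _ dS])
      (auto intro!: derivative_eq_intros)
  then have "Diff (\<lambda>x. S (u, x)) u' = L o\<^sub>L ?r"
    by (intro Diff_eqI) (simp add: blinfun_compose.rep_eq r comp_def)
  then show "blinfun_apply (Diff2 S p) x = L (0, x)"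
    by (simp add: Diff2_def p r)
qed

lemma has_derivative_partials:
  assumes "smooth_on W S" "p \<in> W"
  shows "(S has_derivative (\<lambda>(x, y). Diff1 S p x + Diff2 S p y)) (at p)"
proof -
  note d = smooth_on_has_derivative[OF assms]
  have "blinfun_apply (Diff S p) = (\<lambda>(x, y). Diff1 S p x + Diff2 S p y)"
    by (auto simp: Diff_partial[OF d] simp flip: blinfun.add_right)
  then show ?thesis using d by simp
qed

lemma continuous_on_Diff2:
  assumes "smooth_on W S"
  shows "continuous_on W (Diff2 S)"
proof (rule continuous_on_blinfun_componentwise)
  fix i
  have "continuous_on W (\<lambda>p. blinfun_apply (Diff S p) (0, i))"
    by (intro continuous_intros smooth_on_continuous_on_Diff assms)
  then show "continuous_on W (\<lambda>p. blinfun_apply (Diff2 S p) i)"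
    by (rule continuous_on_eq) (simp add: Diff_partial[OF smooth_on_has_derivative[OF assms]])
qed

lemma has_derivative_S_tilde:
  assumes "smooth_on W S" "(u, u') \<in> W" "smooth_on X b" "u \<in> X" "smooth_on Y b'" "u' \<in> Y"
  shows "(S_tilde S b b' has_derivative
    (\<lambda>(x, y). (Diff1 S (u, u') x - Diff b u x) + (Diff2 S (u, u') y + Diff b' u' y))) (at (u, u'))"
proof -
  have b: "(b has_derivative Diff b u) (at (fst (u, u')))"
    and b': "(b' has_derivative Diff b' u') (at (snd (u, u')))"
    using assms by (simp_all add: smooth_on_has_derivative)
  have "((\<lambda>p. b (fst p)) has_derivative (\<lambda>p. Diff b u (fst p))) (at (u, u'))"
    by (rule has_derivative_compose[where g = b and f = fst, OF _ b])
      (auto intro!: derivative_eq_intros)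
  moreover have "((\<lambda>p. b' (snd p)) has_derivative (\<lambda>p. Diff b' u' (snd p))) (at (u, u'))"
    by (rule has_derivative_compose[where g = b' and f = snd, OF _ b'])
      (auto intro!: derivative_eq_intros)
  ultimately have "((\<lambda>p. S p - (b (fst p) - b' (snd p))) has_derivative
      (\<lambda>p. (case p of (x, y) \<Rightarrow> Diff1 S (u, u') x + Diff2 S (u, u') y)
        - (Diff b u (fst p) - Diff b' u' (snd p)))) (at (u, u'))"
    by (intro has_derivative_diff has_derivative_partials[OF assms(1,2)])
  moreover have "S_tilde S b b' = (\<lambda>p. S p - (b (fst p) - b' (snd p)))"
    by (auto simp: S_tilde_def)
  ultimately have "(S_tilde S b b' has_derivative
      (\<lambda>p. (case p of (x, y) \<Rightarrow> Diff1 S (u, u') x + Diff2 S (u, u') y)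
        - (Diff b u (fst p) - Diff b' u' (snd p)))) (at (u, u'))"
    by simp
  then show ?thesis
    by (rule has_derivative_eq_rhs) auto
qed

text \<open>The differential splits into independent parts for the two factors, each tested by
  setting the other direction to 0. The minus in \<open>- Diff2 S\<close> matches the minus before
  the second boundary function in B.\<close>

lemma critical_point_S_tilde_iff:
  assumes "smooth_on W S" "(u, u') \<in> W" "smooth_on X b" "u \<in> X" "smooth_on Y b'" "u' \<in> Y"
  shows "critical_point (S_tilde S b b') (u, u') \<longleftrightarrow>
    Diff1 S (u, u') = Diff b u \<and> - Diff2 S (u, u') = Diff b' u'"
    (is "?c \<longleftrightarrow> ?e")
proof -
  let ?L = "\<lambda>(x, y). (Diff1 S (u, u') x - Diff b u x) + (Diff2 S (u, u') y + Diff b' u' y)"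
  have d: "(S_tilde S b b' has_derivative ?L) (at (u, u'))"
    using assms by (rule has_derivative_S_tilde)
  show ?thesis
  proof
    assume ?c
    then have "?L = (\<lambda>_. 0)"
      using d has_derivative_unique unfolding critical_point_def by blast
    then have L: "(Diff1 S (u, u') x - Diff b u x) + (Diff2 S (u, u') y + Diff b' u' y) = 0" for x y
      by (metis (mono_tags, lifting) case_prod_conv)
    have "Diff1 S (u, u') x = Diff b u x" for x
      using L[of x 0] by simp
    moreover have "- Diff2 S (u, u') y = Diff b' u' y" for y
      using L[of 0 y] by simp
    ultimately show ?e
      by (auto intro!: blinfun_eqI simp: blinfun.minus_left)
  next
    assume ?e
    then have "Diff b u = Diff1 S (u, u')" "Diff b' u' = - Diff2 S (u, u')"
      by simp_all
    then have "?L = (\<lambda>_. 0)"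
      by (auto simp: blinfun.minus_left)
    then show ?c
      using d unfolding critical_point_def by simp
  qed
qed

section \<open>Generating functions\<close>

text \<open>A point of the graph of \<open>\<phi>\<close> is determined by its two base coordinates.
  This and the next lemma read the set equality in its two directions.\<close>

lemma generating_functionD:
  assumes "generating_function D \<phi> W S" "v \<in> D"
  shows "(fst v, fst (\<phi> v)) \<in> W"
    and "v = (fst v, Diff1 S (fst v, fst (\<phi> v)))"
    and "\<phi> v = (fst (\<phi> v), - Diff2 S (fst v, fst (\<phi> v)))"
proof -
  have "(v, \<phi> v) \<in> {((u, Diff1 S (u, u')), (u', - Diff2 S (u, u'))) |u u'. (u, u') \<in> W}"
    using assms unfolding generating_function_def by blast
  then obtain u u' where "(u, u') \<in> W" "v = (u, Diff1 S (u, u'))" "\<phi> v = (u', - Diff2 S (u, u'))"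
    by blast
  then show "(fst v, fst (\<phi> v)) \<in> W"
    and "v = (fst v, Diff1 S (fst v, fst (\<phi> v)))"
    and "\<phi> v = (fst (\<phi> v), - Diff2 S (fst v, fst (\<phi> v)))"
    by simp_all
qed

lemma generating_function_point:
  assumes "generating_function D \<phi> W S" "(u, u') \<in> W"
  shows "(u, Diff1 S (u, u')) \<in> D" "\<phi> (u, Diff1 S (u, u')) = (u', - Diff2 S (u, u'))"
proof -
  have "((u, Diff1 S (u, u')), (u', - Diff2 S (u, u'))) \<in> {(v, \<phi> v) |v. v \<in> D}"
    using assms unfolding generating_function_def by blast
  then show "(u, Diff1 S (u, u')) \<in> D" "\<phi> (u, Diff1 S (u, u')) = (u', - Diff2 S (u, u'))"
    by auto
qed

lemma bvp_solutions_bij_betw_critical_points: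
  assumes gen: "generating_function D \<phi> W S" and b: "smooth_on X b" and b': "smooth_on Y b'"
  shows "bij_betw (\<lambda>v. (fst v, fst (\<phi> v))) (bvp_solutions D \<phi> X b Y b')
    {p \<in> W \<inter> (X \<times> Y). critical_point (S_tilde S b b') p}"
\<comment> \<open>The inverse sends a critical point to the start of the graph point over it, that
  is, to the initial value of the boundary value problem.\<close>
proof (rule bij_betwI[where g = "\<lambda>p. (fst p, Diff1 S p)"])
  have S: "smooth_on W S" using gen unfolding generating_function_def by blast
  note crit = critical_point_S_tilde_iff[OF S _ b _ b']
  show "(\<lambda>v. (fst v, fst (\<phi> v))) \<in> bvp_solutions D \<phi> X b Y b' \<rightarrow>
      {p \<in> W \<inter> (X \<times> Y). critical_point (S_tilde S b b') p}"
  proof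
    fix v assume "v \<in> bvp_solutions D \<phi> X b Y b'"
    then have v: "v \<in> D" "fst v \<in> X" "snd v = Diff b (fst v)"
        "fst (\<phi> v) \<in> Y" "snd (\<phi> v) = Diff b' (fst (\<phi> v))"
      by (auto simp: bvp_solutions_def graph_d_def)
    note g = generating_functionD[OF gen v(1)]
    have "Diff1 S (fst v, fst (\<phi> v)) = Diff b (fst v)"
        "- Diff2 S (fst v, fst (\<phi> v)) = Diff b' (fst (\<phi> v))"
      using g(2,3) v(3,5) by (metis snd_conv)+
    then show "(fst v, fst (\<phi> v)) \<in> {p \<in> W \<inter> (X \<times> Y). critical_point (S_tilde S b b') p}"
      using crit[OF g(1) v(2,4)] g(1) v(2,4) by simp
  qed
  show "(\<lambda>p. (fst p, Diff1 S p)) \<in> {p \<in> W \<inter> (X \<times> Y). critical_point (S_tilde S b b') p} \<rightarrow>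
      bvp_solutions D \<phi> X b Y b'"
    using generating_function_point[OF gen] crit
    by (fastforce simp: bvp_solutions_def graph_d_def)
  show "(fst (fst v, fst (\<phi> v)), Diff1 S (fst v, fst (\<phi> v))) = v"
    if "v \<in> bvp_solutions D \<phi> X b Y b'" for v
    using that generating_functionD(2)[OF gen] by (simp add: bvp_solutions_def)
  show "(fst (fst p, Diff1 S p), fst (\<phi> (fst p, Diff1 S p))) = p"
    if "p \<in> {p \<in> W \<inter> (X \<times> Y). critical_point (S_tilde S b b') p}" for p
    using that generating_function_point[OF gen] by (cases p) auto
qed

section \<open>The symmetry of the generating function\<close>

lemma continuous_on_swap_prod:
  assumes "continuous_on A h"
  shows "continuous_on (A \<times> A) (swap_prod h)"
  unfolding swap_prod_def case_prod_beta
  by (intro continuous_intros continuous_on_compose2[OF assms]) auto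

lemma open_symmetry_domain:
  assumes h: "diffeo_on A h" and phi: "diffeo_on D \<phi>" and gen: "generating_function D \<phi> W S"
    and "open X" "open Y"
  shows "open (symmetry_domain A h D \<phi> W S X Y)"
proof -
  have W: "open W" "smooth_on W S" using gen unfolding generating_function_def by auto
  have A: "open A" "continuous_on A h"
    using h smooth_on_continuous_on unfolding diffeo_on_def by auto
  have "open ((A \<times> A) \<inter> swap_prod h -` (W \<inter> (X \<times> Y)))"
    using W A assms by (intro continuous_open_preimage continuous_on_swap_prod open_Times open_Int)
  moreover have "open (W \<inter> (\<lambda>p. (snd p, - Diff2 S p)) -` reversal_domain D \<phi> (A \<times> UNIV) (Psi h))"
    by (intro continuous_open_preimage open_reversal_domain h phi W continuous_intros
        continuous_on_Diff2)
  moreover have "open (W \<inter> (X \<times> Y))"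
    using W assms by (intro open_Times open_Int)
  \<comment> \<open>The reversal condition is pulled back along the map taking \<open>p\<close> to
    the image point \<open>\<phi> v\<close> of the graph point over \<open>p\<close>.\<close>
  moreover have "symmetry_domain A h D \<phi> W S X Y = (W \<inter> (X \<times> Y))
      \<inter> ((A \<times> A) \<inter> swap_prod h -` (W \<inter> (X \<times> Y)))
      \<inter> (W \<inter> (\<lambda>p. (snd p, - Diff2 S p)) -` reversal_domain D \<phi> (A \<times> UNIV) (Psi h))"
    unfolding symmetry_domain_def by auto
  ultimately show ?thesis by (simp only: open_Int)
qed

text \<open>The graph point over the origin is \<open>(0, 0)\<close> because \<open>\<phi>\<close>
  fixes 0, and \<open>Psi h\<close> fixes 0 because it is linear on fibres. With openness, the
  symmetry domain is then a neighbourhood of 0.\<close>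

lemma zero_in_symmetry_domain:
  assumes "0 \<in> A" "0 \<in> D" "0 \<in> X" "0 \<in> Y" "generating_function D \<phi> W S" "h 0 = 0" "\<phi> 0 = 0"
  shows "0 \<in> symmetry_domain A h D \<phi> W S X Y"
proof -
  have g: "(0, 0) \<in> W" "- Diff2 S (0, 0) = 0"
    using generating_functionD[OF assms(5,2)] assms(7) by (simp_all add: zero_prod_def)
  have P: "Psi h 0 = 0"
    using assms(6) by (simp add: Psi_def zero_prod_def)
  have "0 \<in> \<phi> ` D"
    using assms(2,7) by (metis imageI)
  moreover have "0 \<in> A \<times> UNIV"
    using assms(1) by (simp add: zero_prod_def)
  moreover from this have "0 \<in> Psi h ` (A \<times> UNIV)"
    using P by (metis imageI)
  ultimately have "0 \<in> reversal_domain D \<phi> (A \<times> UNIV) (Psi h)"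
    using assms(2,7) P by (simp add: reversal_domain_def)
  then have "(0, 0) \<in> symmetry_domain A h D \<phi> W S X Y"
    unfolding symmetry_domain_def
    using assms g by (simp add: swap_prod_def zero_prod_def)
  then show ?thesis by (simp add: zero_prod_def)
qed

text \<open>If \<open>\<phi> v = w\<close> then the reversal identity gives \<open>\<phi> (\<Psi> w) = \<Psi> v\<close>, so the point
  \<open>(\<Psi> w, \<Psi> v)\<close> of the graph of \<open>\<phi>\<close> lies over \<open>swap_prod h (u, u')\<close>.\<close>

lemma reversal_generating_function:
  assumes gen: "generating_function D \<phi> W S" and inj: "inj_on \<phi> D"
    and rev: "reversal_symmetry D \<phi> (A \<times> UNIV) (Psi h)"
    and W: "(u, u') \<in> W"
    and w: "(u', - Diff2 S (u, u')) \<in> reversal_domain D \<phi> (A \<times> UNIV) (Psi h)"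
  shows "Psi h (u', - Diff2 S (u, u')) = (h u', Diff1 S (h u', h u))"
    and "Psi h (u, Diff1 S (u, u')) = (h u, - Diff2 S (h u', h u))"
proof -
  let ?v = "(u, Diff1 S (u, u'))" and ?w = "(u', - Diff2 S (u, u'))"
  have v: "?v \<in> D" "\<phi> ?v = ?w"
    using generating_function_point[OF gen W] by auto
  have "inv_into (A \<times> UNIV) (Psi h) (\<phi> (Psi h ?w)) = inv_into D \<phi> ?w"
    using rev w unfolding reversal_symmetry_def by blast
  also have "\<dots> = ?v"
    using v inj inv_into_f_f by metis
  \<comment> \<open>The reversal domain puts \<open>\<phi> (Psi h ?w)\<close> into the range of
    \<open>Psi h\<close>, so applying \<open>Psi h\<close> undoes \<open>inv_into\<close>.\<close>
  finally have *: "\<phi> (Psi h ?w) = Psi h ?v"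
    using w f_inv_into_f[of "\<phi> (Psi h ?w)" "Psi h" "A \<times> UNIV"] unfolding reversal_domain_def by auto
  have D: "Psi h ?w \<in> D"
    using w unfolding reversal_domain_def by blast
  have f: "fst (Psi h ?w) = h u'" "fst (Psi h ?v) = h u"
    by (simp_all add: Psi_def)
  show "Psi h ?w = (h u', Diff1 S (h u', h u))" "Psi h ?v = (h u, - Diff2 S (h u', h u))"
    using generating_functionD(2,3)[OF gen D] unfolding * f by auto
qed

lemma has_derivative_swap_prod:
  assumes "smooth_on A h" "u \<in> A" "u' \<in> A"
  shows "(swap_prod h has_derivative (\<lambda>(x, y). (Diff h u' y, Diff h u x))) (at (u, u'))"
proof -
  have hu: "(h has_derivative Diff h u) (at (fst (u, u')))"
    and hu': "(h has_derivative Diff h u') (at (snd (u, u')))"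
    using assms by (simp_all add: smooth_on_has_derivative)
  have "((\<lambda>p. h (fst p)) has_derivative (\<lambda>p. Diff h u (fst p))) (at (u, u'))"
    by (rule has_derivative_compose[where g = h and f = fst, OF _ hu])
      (auto intro!: derivative_eq_intros)
  moreover have "((\<lambda>p. h (snd p)) has_derivative (\<lambda>p. Diff h u' (snd p))) (at (u, u'))"
    by (rule has_derivative_compose[where g = h and f = snd, OF _ hu'])
      (auto intro!: derivative_eq_intros)
  ultimately show ?thesis
    unfolding swap_prod_def case_prod_beta by (intro has_derivative_Pair)
qed

text \<open>By the chain rule, composing with \<open>swap_prod h\<close> exchanges the two partial
  differentials, and the symmetry of \<open>\<phi>\<close> and of the boundary conditions turns them
  back into the original ones.\<close>

lemma S_tilde_swap_prod_derivative_zero: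
  assumes h: "diffeo_on A h" and inj: "inj_on \<phi> D" and gen: "generating_function D \<phi> W S"
    and rev: "reversal_symmetry D \<phi> (A \<times> UNIV) (Psi h)"
    and b: "smooth_on X b" "smooth_on Y b'"
    and inv: "Psi_maps_graph A h X b Y b'" "Psi_maps_graph A h Y b' X b"
    and p: "p \<in> symmetry_domain A h D \<phi> W S X Y"
  shows "((\<lambda>p. (S_tilde S b b' \<circ> swap_prod h) p - S_tilde S b b' p) has_derivative (\<lambda>_. 0)) (at p)"
proof -
  obtain u u' where pu: "p = (u, u')" by fastforce
  have *: "(u, u') \<in> W" "u \<in> X" "u' \<in> Y" "u \<in> A" "u' \<in> A"
      "(h u', h u) \<in> W" "h u' \<in> X" "h u \<in> Y"
      "(u', - Diff2 S (u, u')) \<in> reversal_domain D \<phi> (A \<times> UNIV) (Psi h)"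
    using p unfolding symmetry_domain_def pu swap_prod_def by auto
  have S: "smooth_on W S" "smooth_on A h"
    using gen h unfolding generating_function_def diffeo_on_def by blast+
  note r = reversal_generating_function[OF gen inj rev *(1,9)]
  \<comment> \<open>The sign of \<open>- Diff2 S\<close> and the sign in \<open>Psi\<close> cancel,
    here and in \<open>2\<close>.\<close>
  have 1: "Diff1 S (h u', h u) (Diff h u' y) = Diff2 S (u, u') y" for y
    using Psi_snd_Diff[OF h *(5) r(1), of y] by (simp add: blinfun.minus_left)
  have 2: "Diff2 S (h u', h u) (Diff h u x) = Diff1 S (u, u') x" for x
    using Psi_snd_Diff[OF h *(4) r(2), of x] by (simp add: blinfun.minus_left)
  \<comment> \<open>Here a sign remains. It is absorbed by B, in which \<open>b\<close> and
    \<open>b'\<close> have opposite signs and are exchanged by the swap.\<close>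
  have 3: "Diff b' (h u) (Diff h u x) = - Diff b u x" for x
    using Psi_maps_graph_Diff[OF h inv(1)] * by simp
  have 4: "Diff b (h u') (Diff h u' y) = - Diff b' u' y" for y
    using Psi_maps_graph_Diff[OF h inv(2)] * by simp
  have "(S_tilde S b b' has_derivative
      (\<lambda>(x, y). (Diff1 S (h u', h u) x - Diff b (h u') x) + (Diff2 S (h u', h u) y + Diff b' (h u) y)))
      (at (swap_prod h (u, u')))"
    using has_derivative_S_tilde[OF S(1) *(6) b(1) *(7) b(2) *(8)] by (simp add: swap_prod_def)
  from has_derivative_compose[OF has_derivative_swap_prod[OF S(2) *(4,5)] this]
  have "((\<lambda>p. S_tilde S b b' (swap_prod h p)) has_derivative
      (\<lambda>(x, y). (Diff1 S (u, u') x - Diff b u x) + (Diff2 S (u, u') y + Diff b' u' y))) (at (u, u'))"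
    by (rule has_derivative_eq_rhs) (auto simp: 1 2 3 4)
  from has_derivative_diff[OF this has_derivative_S_tilde[OF S(1) *(1) b(1) *(2) b(2) *(3)]]
  show ?thesis
    by (simp add: pu)
qed

text \<open>Locality is expressed by explicit domains: the additive constant may depend on \<mu> and
  on the connected set \<open>C\<close>. If \<open>h\<close> and \<open>\<phi> \<mu>\<close> fix 0,
  a small ball around 0 is an admissible \<open>C\<close>.\<close>

theorem corollary3p5:
  fixes h :: "'u::euclidean_space \<Rightarrow> 'u"
    and A :: "'u set"
    and M :: "'m set"
    and \<phi> :: "'m \<Rightarrow> 'u cotangent \<Rightarrow> 'u cotangent" and D :: "'m \<Rightarrow> 'u cotangent set"
    and S :: "'m \<Rightarrow> 'u \<times> 'u \<Rightarrow> real" and W :: "'m \<Rightarrow> ('u \<times> 'u) set"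
    and b b' :: "'m \<Rightarrow> 'u \<Rightarrow> real" and X Y :: "'m \<Rightarrow> 'u set"
  assumes h: "0 \<in> A" "diffeo_on A h"
    and phi: "\<And>\<mu>. \<mu> \<in> M \<Longrightarrow> 0 \<in> D \<mu> \<and> symplectic_on (D \<mu>) (\<phi> \<mu>)"
    and gen: "\<And>\<mu>. \<mu> \<in> M \<Longrightarrow> 0 \<in> W \<mu> \<and> generating_function (D \<mu>) (\<phi> \<mu>) (W \<mu>) (S \<mu>)"
    and rev: "\<And>\<mu>. \<mu> \<in> M \<Longrightarrow> reversal_symmetry (D \<mu>) (\<phi> \<mu>) (A \<times> UNIV) (Psi h)"
    and bdry: "\<And>\<mu>. \<mu> \<in> M \<Longrightarrow> open (X \<mu>) \<and> 0 \<in> X \<mu> \<and> smooth_on (X \<mu>) (b \<mu>)"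
              "\<And>\<mu>. \<mu> \<in> M \<Longrightarrow> open (Y \<mu>) \<and> 0 \<in> Y \<mu> \<and> smooth_on (Y \<mu>) (b' \<mu>)"
    and inv1: "\<And>\<mu>. \<mu> \<in> M \<Longrightarrow> Psi_maps_graph A h (X \<mu>) (b \<mu>) (Y \<mu>) (b' \<mu>)"
    and inv2: "\<And>\<mu>. \<mu> \<in> M \<Longrightarrow> Psi_maps_graph A h (Y \<mu>) (b' \<mu>) (X \<mu>) (b \<mu>)"
  shows "\<forall>\<mu>\<in>M.
     bij_betw (\<lambda>v. (fst v, fst (\<phi> \<mu> v)))
       (bvp_solutions (D \<mu>) (\<phi> \<mu>) (X \<mu>) (b \<mu>) (Y \<mu>) (b' \<mu>))
       {p \<in> W \<mu> \<inter> (X \<mu> \<times> Y \<mu>). critical_point (S_tilde (S \<mu>) (b \<mu>) (b' \<mu>)) p} \<and>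
     open (symmetry_domain A h (D \<mu>) (\<phi> \<mu>) (W \<mu>) (S \<mu>) (X \<mu>) (Y \<mu>)) \<and>
     (h 0 = 0 \<and> \<phi> \<mu> 0 = 0 \<longrightarrow>
        0 \<in> symmetry_domain A h (D \<mu>) (\<phi> \<mu>) (W \<mu>) (S \<mu>) (X \<mu>) (Y \<mu>)) \<and>
     (\<forall>C. connected C \<and> C \<subseteq> symmetry_domain A h (D \<mu>) (\<phi> \<mu>) (W \<mu>) (S \<mu>) (X \<mu>) (Y \<mu>) \<longrightarrow>
        (\<exists>c. \<forall>p\<in>C. (S_tilde (S \<mu>) (b \<mu>) (b' \<mu>) \<circ> swap_prod h) p
                    = S_tilde (S \<mu>) (b \<mu>) (b' \<mu>) p + c))"
proof (intro ballI conjI impI allI)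
  fix \<mu> assume \<mu>: "\<mu> \<in> M"
  have phi': "diffeo_on (D \<mu>) (\<phi> \<mu>)" "inj_on (\<phi> \<mu>) (D \<mu>)"
    using phi[OF \<mu>] unfolding symplectic_on_def diffeo_on_def by blast+
  have gen': "generating_function (D \<mu>) (\<phi> \<mu>) (W \<mu>) (S \<mu>)"
    using gen[OF \<mu>] by blast
  have b: "smooth_on (X \<mu>) (b \<mu>)" "smooth_on (Y \<mu>) (b' \<mu>)"
    using bdry[OF \<mu>] by blast+
  let ?\<Omega> = "symmetry_domain A h (D \<mu>) (\<phi> \<mu>) (W \<mu>) (S \<mu>) (X \<mu>) (Y \<mu>)"
  let ?S = "S_tilde (S \<mu>) (b \<mu>) (b' \<mu>)"
  show "bij_betw (\<lambda>v. (fst v, fst (\<phi> \<mu> v)))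
      (bvp_solutions (D \<mu>) (\<phi> \<mu>) (X \<mu>) (b \<mu>) (Y \<mu>) (b' \<mu>))
      {p \<in> W \<mu> \<inter> (X \<mu> \<times> Y \<mu>). critical_point ?S p}"
    using gen' b by (rule bvp_solutions_bij_betw_critical_points)
  show op: "open ?\<Omega>"
    using h(2) phi'(1) gen' bdry[OF \<mu>] by (intro open_symmetry_domain) auto
  show "0 \<in> ?\<Omega>" if "h 0 = 0 \<and> \<phi> \<mu> 0 = 0"
    using that h(1) phi[OF \<mu>] gen' bdry[OF \<mu>] by (intro zero_in_symmetry_domain) auto
  fix C assume C: "connected C \<and> C \<subseteq> ?\<Omega>"
  show "\<exists>c. \<forall>p\<in>C. (?S \<circ> swap_prod h) p = ?S p + c"
  proof -
    \<comment> \<open>Only differentials are controlled by the symmetry, so the identity for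
      \<open>?S\<close> itself is recovered by integration, up to a constant.\<close>
    have zero: "((\<lambda>p. (?S \<circ> swap_prod h) p - ?S p) has_derivative (\<lambda>_. 0)) (at p)" if "p \<in> ?\<Omega>" for p
      using h(2) phi'(2) gen' rev[OF \<mu>] b inv1[OF \<mu>] inv2[OF \<mu>] that
      by (rule S_tilde_swap_prod_derivative_zero)
    obtain c where c: "\<forall>p\<in>C. (?S \<circ> swap_prod h) p - ?S p = c"
      using has_derivative_zero_constant_on_connected_subset[OF op zero] C by blast
    have "(?S \<circ> swap_prod h) p = ?S p + c" if "p \<in> C" for p
      using c[rule_format, OF that] by linarith
    then show ?thesis by blast
  qed
qed

end
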